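(* Let $\mathscr{B}$ be the set of positive integers $n$ such that there are, up to isomorphism, only finitely many finite noncyclic groups with precisely $n$ cyclic subgroups. Then $\mathscr{B}=\{1,4,6,9\}\cup\mathscr{P}$, where $\mathscr{P}$ is the set of prime numbers.
   Context: The cyclic subgroups of a group are counted including the trivial subgroup. If there are no finite noncyclic groups with precisely $n$ cyclic subgroups, then $n\in\mathscr{B}$. *)

theory Defs
  imports "HOL-Algebra.Elementary_Groups" "HOL-Computational_Algebra.Primes"
begin

definition cyclic_subgroups :: "('a, 'b) monoid_scheme \<Rightarrow> 'a set set"
  where "cyclic_subgroups G = {H. subgroup H G \<and> cyclic_group (G\<lparr>carrier := H\<rparr>)}"

text \<open>
  Every finite group is isomorphic to one whose carrier is a set of natural numbers, so
  element type \<^typ>\<open>nat\<close> loses no isomorphism class; see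
  \<open>noncyclic_groups_represented\<close> below.
\<close>

definition noncyclic_groups :: "nat \<Rightarrow> nat monoid set"
  where "noncyclic_groups n =
    {G. group G \<and> finite (carrier G) \<and> \<not> cyclic_group G \<and> card (cyclic_subgroups G) = n}"

definition noncyclic_group_iso :: "nat \<Rightarrow> (nat monoid \<times> nat monoid) set"
  where "noncyclic_group_iso n =
    {(G, H). G \<in> noncyclic_groups n \<and> H \<in> noncyclic_groups n \<and> G \<cong> H}"

definition scrB :: "nat set"
  where "scrB = {n. 0 < n \<and> finite (noncyclic_groups n // noncyclic_group_iso n)}"

lemma equiv_noncyclic_group_iso: "equiv (noncyclic_groups n) (noncyclic_group_iso n)"
proof (rule equivI)
  show "noncyclic_group_iso n \<subseteq> noncyclic_groups n \<times> noncyclic_groups n"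
    by (auto simp: noncyclic_group_iso_def)
  show "refl_on (noncyclic_groups n) (noncyclic_group_iso n)"
    by (auto simp: refl_on_def noncyclic_group_iso_def)
  show "sym (noncyclic_group_iso n)"
    by (auto simp: sym_def noncyclic_group_iso_def noncyclic_groups_def intro: group.iso_sym)
  show "trans (noncyclic_group_iso n)"
    by (auto simp: trans_def noncyclic_group_iso_def intro: iso_trans)
qed

lemma cyclic_subgroups_iso_image:
  assumes G: "group G" and K: "group K" and f: "f \<in> iso G K"
    and H: "H \<in> cyclic_subgroups G"
  shows "f ` H \<in> cyclic_subgroups K"
proof -
  interpret group_hom G K f
    using assms by (auto simp: group_hom_def group_hom_axioms_def iso_def)
  have sub: "subgroup H G" and cyc: "cyclic_group (G\<lparr>carrier := H\<rparr>)"
    using H by (auto simp: cyclic_subgroups_def)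
  have HG: "H \<subseteq> carrier G"
    using sub by (rule subgroup.subset)
  have sub': "subgroup (f ` H) K"
    using sub by (rule subgroup_img_is_subgroup)
  have grp: "group (G\<lparr>carrier := H\<rparr>)"
    using G sub by (rule group.subgroup_imp_group)
  have grp': "group (K\<lparr>carrier := f ` H\<rparr>)"
    using K sub' by (rule group.subgroup_imp_group)
  have "f \<in> epi (G\<lparr>carrier := H\<rparr>) (K\<lparr>carrier := f ` H\<rparr>)"
    using HG by (auto simp: epi_def hom_def subset_iff)
  then have "cyclic_group (K\<lparr>carrier := f ` H\<rparr>)"
    using group.cyclic_group_epimorphic_image[OF grp] cyc grp' by blast
  with sub' show ?thesis
    by (simp add: cyclic_subgroups_def)
qed

lemma card_cyclic_subgroups_iso:
  assumes G: "group G" and K: "group K" and "G \<cong> K"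
  shows "card (cyclic_subgroups G) = card (cyclic_subgroups K)"
proof -
  obtain f where f: "f \<in> iso G K"
    using assms by (auto simp: is_iso_def)
  define g where "g = inv_into (carrier G) f"
  have g: "g \<in> iso K G"
    unfolding g_def using G f by (rule group.iso_set_sym)
  have bij: "bij_betw f (carrier G) (carrier K)"
    using f by (simp add: iso_def)
  have gf: "g ` f ` H = H" if "H \<in> cyclic_subgroups G" for H
    using that bij unfolding g_def
    by (intro inv_into_image_cancel) (auto simp: bij_betw_def cyclic_subgroups_def dest: subgroup.subset)
  have fg: "f ` g ` H = H" if "H \<in> cyclic_subgroups K" for H
    using that bij unfolding g_def
    by (intro image_inv_into_cancel) (auto simp: bij_betw_def cyclic_subgroups_def dest: subgroup.subset)
  have "bij_betw ((`) f) (cyclic_subgroups G) (cyclic_subgroups K)"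
    by (rule bij_betw_byWitness[where f' = "(`) g"])
      (use gf fg cyclic_subgroups_iso_image[OF G K f] cyclic_subgroups_iso_image[OF K G g] in auto)
  then show ?thesis
    by (rule bij_betw_same_card)
qed

lemma finite_group_iso_nat:
  fixes G :: "'a monoid"
  assumes "group G" and "finite (carrier G)"
  obtains K :: "nat monoid" where "group K" "G \<cong> K"
proof -
  interpret group G by fact
  obtain f :: "'a \<Rightarrow> nat" where f: "inj_on f (carrier G)"
    using finite_imp_inj_to_nat_seg[OF assms(2)] by blast
  define g where "g = inv_into (carrier G) f"
  have gf [simp]: "g (f x) = x" if "x \<in> carrier G" for x
    using f that by (simp add: g_def)
  define K where "K = \<lparr>carrier = f ` carrier G, monoid.mult = (\<lambda>x y. f (g x \<otimes>\<^bsub>G\<^esub> g y)), one = f \<one>\<^bsub>G\<^esub>\<rparr>"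
  have iso: "f \<in> iso G K"
    using f by (auto simp: iso_def hom_def bij_betw_def K_def)
  have "group K"
  proof (rule groupI)
    fix x assume "x \<in> carrier K"
    then obtain a where "a \<in> carrier G" "x = f a" by (auto simp: K_def)
    then show "\<exists>y\<in>carrier K. y \<otimes>\<^bsub>K\<^esub> x = \<one>\<^bsub>K\<^esub>"
      by (intro bexI[of _ "f (inv\<^bsub>G\<^esub> a)"]) (auto simp: K_def)
  qed (auto simp: K_def m_assoc)
  with that iso show ?thesis
    by (auto simp: is_iso_def)
qed

lemma noncyclic_groups_represented:
  fixes G :: "'a monoid"
  assumes "group G" and "finite (carrier G)" and "\<not> cyclic_group G"
  obtains K where "K \<in> noncyclic_groups (card (cyclic_subgroups G))" "G \<cong> K"
proof -
  obtain K :: "nat monoid" where K: "group K" "G \<cong> K"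
    using finite_group_iso_nat assms by blast
  then have "finite (carrier K)"
    using assms iso_finite by blast
  moreover have "\<not> cyclic_group K"
    using isomorphic_group_cyclicity[OF K(2)] assms K by blast
  ultimately show ?thesis
    using that K card_cyclic_subgroups_iso[OF assms(1) K]
    by (auto simp: noncyclic_groups_def)
qed

end

theory Submission
  imports Defs "HOL-Algebra.Multiplicative_Group" "HOL-Number_Theory.Cong"
begin

text \<open>
  Write \<open>c(G)\<close> for the number of cyclic subgroups. The numbers \<open>1, 4, 6, 9\<close> and the primes are
  exactly the \<open>n > 0\<close> all of whose proper divisors are less than \<open>4\<close>.

  Let \<open>G\<close> be noncyclic with \<open>c(G) = n\<close>, and suppose a prime \<open>p > n\<close> divides the order of an
  element. Take \<open>x\<close> of maximal \<open>p\<close>-power order \<open>p\<^sup>a\<close>. For each \<open>g\<close> two of the \<open>n + 1\<close> subgroups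
  \<open>\<langle>x\<^sup>i g\<rangle>\<close> with \<open>i \<le> n\<close> coincide, which forces \<open>\<langle>x, g\<rangle>\<close> to be cyclic. Hence
  \<open>n = (a + 1) k\<close>, where \<open>k\<close> counts the cyclic subgroups containing \<open>x\<close>; these cover \<open>G\<close>, so
  \<open>k \<ge> 4\<close>. Thus if all proper divisors of \<open>n\<close> are less than \<open>4\<close>, all such primes are at
  most \<open>n\<close>, and the order of \<open>G\<close> is bounded.

  Conversely, a proper divisor \<open>k \<ge> 4\<close> of \<open>n = k j\<close> can be chosen to be \<open>4\<close> or odd, and then
  there is a noncyclic \<open>H\<close> with \<open>c(H) = k\<close>: the Klein four-group, or the extension of \<open>\<int>/2\<^sup>m\<close>
  by \<open>\<int>/3\<close> with \<open>c(H) = 2 m + 3\<close>. The groups \<open>H \<times> \<int>/r\<^sup>j\<^sup>-\<^sup>1\<close> with \<open>r\<close> a large prime all have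
  \<open>n\<close> cyclic subgroups.
\<close>

section \<open>Cyclic subgroups of a finite group\<close>

lemma (in group) generate_singleton_mono:
  assumes "y \<in> carrier G" "x \<in> generate G {y}"
  shows "generate G {x} \<subseteq> generate G {y}"
  using assms by (intro generate_subgroup_incl generate_is_subgroup) auto

lemma (in group) generate_singleton_subset:
  "x \<in> carrier G \<Longrightarrow> generate G {x} \<subseteq> carrier G"
  by (rule generate_incl) simp

lemma (in group) generate_singleton_self: "x \<in> generate G {x}"
  by (simp add: generate.incl)

lemma (in group) nat_pow_in_generate:
  assumes "y \<in> carrier G" "x \<in> generate G {y}"
  shows "x [^] (k::nat) \<in> generate G {y}"
  using subgroup_int_pow_closed[OF generate_is_subgroup[of "{y}"], of x "int k"] assms
  by (simp add: int_pow_int)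

text \<open>Replaces the two defining conditions by an image of the carrier, so that every cyclic
  subgroup can be handled through a generator.\<close>

lemma (in group) cyclic_subgroups_eq:
  "cyclic_subgroups G = (\<lambda>x. generate G {x}) ` carrier G"
proof (intro equalityI subsetI)
  fix H assume "H \<in> cyclic_subgroups G"
  then have H: "subgroup H G" "cyclic_group (G\<lparr>carrier := H\<rparr>)"
    by (auto simp: cyclic_subgroups_def)
  then obtain x where x: "x \<in> H" "subgroup_generated (G\<lparr>carrier := H\<rparr>) {x} = G\<lparr>carrier := H\<rparr>"
    by (auto simp: cyclic_group_def)
  have "H = carrier (subgroup_generated (G\<lparr>carrier := H\<rparr>) {x})"
    using x by simp
  also have "\<dots> = generate (G\<lparr>carrier := H\<rparr>) {x}"
    using x(1) by (simp add: carrier_subgroup_generated)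
  also have "\<dots> = generate G {x}"
    using x(1) H(1) by (intro generate_consistent) auto
  finally show "H \<in> (\<lambda>x. generate G {x}) ` carrier G"
    using subgroup.subset[OF H(1)] x(1) by blast
next
  fix H assume "H \<in> (\<lambda>x. generate G {x}) ` carrier G"
  then obtain x where x: "x \<in> carrier G" "H = generate G {x}"
    by blast
  have "cyclic_group (subgroup_generated G {x})"
    by (rule cyclic_group_generated)
  with x show "H \<in> cyclic_subgroups G"
    by (auto simp: cyclic_subgroups_def subgroup_generated_def generate_is_subgroup)
qed

lemma (in group) cyclic_group_iff_generate:
  "cyclic_group G \<longleftrightarrow> (\<exists>x\<in>carrier G. generate G {x} = carrier G)"
  by (auto simp: cyclic_group generate_pow full_SetCompr_eq)

locale finite_group = group +
  assumes fin [simp]: "finite (carrier G)"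
begin

lemma ord_pos: "x \<in> carrier G \<Longrightarrow> 0 < ord x"
  using ord_ge_1[of x] by simp

lemma generate_nat_pow:
  "x \<in> carrier G \<Longrightarrow> generate G {x} = range (\<lambda>k::nat. x [^] k)"
  by (auto simp: generate_pow_on_finite_carrier)

lemma finite_cyclic_subgroups: "finite (cyclic_subgroups G)"
  by (simp add: cyclic_subgroups_eq)

lemma in_generate_ord_dvd:
  assumes y: "y \<in> carrier G" and x: "x \<in> generate G {y}"
  shows "ord x dvd ord y"
proof -
  have xc: "x \<in> carrier G"
    using assms generate_singleton_subset by blast
  obtain k :: nat where "x = y [^] k"
    using assms by (auto simp: generate_nat_pow)
  then have "x [^] ord y = \<one>"
    using y by (simp add: nat_pow_pow mult.commute[of k]) (simp flip: nat_pow_pow)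
  then show ?thesis
    using xc by (simp add: pow_eq_id)
qed

text \<open>The elements of order dividing \<open>m\<close> in a cyclic group whose order is a multiple of
  \<open>m\<close> form a single subgroup of order \<open>m\<close>.\<close>

lemma in_generate_if_ord_dvd:
  assumes g: "g \<in> carrier G" and x: "x \<in> generate G {g}" and y: "y \<in> generate G {g}"
    and dvd: "ord x dvd ord y"
  shows "x \<in> generate G {y}"
proof -
  have xc: "x \<in> carrier G" and yc: "y \<in> carrier G"
    using assms generate_singleton_subset by blast+
  define m where "m = ord y"
  have m: "m dvd ord g" "0 < m"
    using in_generate_ord_dvd[OF g y] ord_pos[OF yc] by (auto simp: m_def)
  then obtain e where e: "ord g = m * e"
    by blast
  have e0: "0 < e"
    using ord_pos[OF g] e by (cases e) auto
  define h where "h = g [^] e"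
  have h: "h \<in> carrier G" and ordh: "ord h = m"
    using g e e0 m by (auto simp: h_def ord_pow)
  have *: "z \<in> generate G {h}" if z: "z \<in> generate G {g}" and zm: "z [^] m = \<one>" for z
  proof -
    obtain k :: nat where k: "z = g [^] k"
      using z g by (auto simp: generate_nat_pow)
    have "g [^] (k * m) = \<one>"
      using zm g by (simp add: k nat_pow_pow)
    then have "e dvd k"
      using g m by (auto simp: pow_eq_id e mult.commute)
    then obtain l where "k = e * l" by blast
    then have "z = h [^] l"
      using g by (simp add: k h_def nat_pow_pow)
    then show ?thesis
      using h by (auto simp: generate_nat_pow)
  qed
  have "generate G {y} = generate G {h}"
  proof (rule card_subset_eq)
    show "finite (generate G {h})"
      using h generate_singleton_subset finite_subset fin by metis
    show "generate G {y} \<subseteq> generate G {h}"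
      using generate_singleton_mono[OF h] *[OF y] yc by (simp add: m_def)
    show "card (generate G {y}) = card (generate G {h})"
      using generate_pow_card[OF yc] generate_pow_card[OF h] by (simp add: ordh m_def)
  qed
  moreover have "x [^] m = \<one>"
    using dvd xc by (simp add: pow_eq_id m_def)
  ultimately show ?thesis
    using *[OF x] by simp
qed

lemma generate_eq_if_ord_eq:
  assumes g: "g \<in> carrier G" and x: "x \<in> generate G {g}" and y: "y \<in> generate G {g}"
    and eq: "ord x = ord y"
  shows "generate G {x} = generate G {y}"
proof -
  have xc: "x \<in> carrier G" and yc: "y \<in> carrier G"
    using assms generate_singleton_subset by blast+
  have "x \<in> generate G {y}" "y \<in> generate G {x}"
    using in_generate_if_ord_dvd[OF g x y] in_generate_if_ord_dvd[OF g y x] eq by auto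
  then show ?thesis
    using generate_singleton_mono xc yc by blast
qed

text \<open>For \<open>k > 0\<close> the power has the same order as \<open>x\<close>, and a cyclic
  group has only one subgroup of each order; \<open>k = 0\<close> is coprime to the order only if
  \<open>x\<close> is trivial.\<close>

lemma pow_generate_coprime:
  assumes x: "x \<in> carrier G" and cop: "coprime k (ord x)"
  shows "x \<in> generate G {x [^] k}"
proof (cases "k = 0")
  case True
  then have "ord x = 1" using cop by simp
  then have "x = \<one>" using x ord_eq_1 by blast
  then show ?thesis by (simp add: generate.one)
next
  case False
  have "ord (x [^] k) = ord x"
    using x False cop by (simp add: ord_pow_gen coprime_iff_gcd_eq_1 gcd.commute)
  then show ?thesis
    using in_generate_if_ord_dvd[OF x generate_singleton_self nat_pow_in_generate[OF x generate_singleton_self]]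
    by simp
qed

text \<open>Powers of \<open>d\<close> commute with taking \<open>k\<close>-th powers, so the image
  of a cyclic subgroup under a power map is cyclic and can be computed from any generator.\<close>

lemma pow_image_generate:
  assumes "d \<in> carrier G"
  shows "(\<lambda>z. z [^] (k::nat)) ` generate G {d} = generate G {d [^] k}"
proof -
  have "(d [^] i) [^] k = (d [^] k) [^] i" for i :: nat
    using assms by (simp add: nat_pow_pow mult.commute)
  then show ?thesis
    using assms by (simp add: generate_nat_pow image_image)
qed

text \<open>\<open>(D, i) \<mapsto> {z ^ (p ^ i) | z \<in> D}\<close>, for \<open>D\<close> a cyclic subgroup containing \<open>x\<close> and \<open>i \<le> a\<close>, is a
  bijection onto all cyclic subgroups: \<open>D\<close> is recovered as the join of its image with \<open>\<langle>x\<rangle>\<close>.\<close>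

lemma card_cyclic_subgroups_split:
  assumes p: "prime p" and x: "x \<in> carrier G" and ordx: "ord x = p ^ a"
    and gen: "\<And>g. g \<in> carrier G \<Longrightarrow> \<exists>i::nat. x \<in> generate G {x [^] i \<otimes> g}"
    and max: "\<And>g. g \<in> carrier G \<Longrightarrow> \<not> p ^ Suc a dvd ord g"
  shows "card (cyclic_subgroups G) = Suc a * card {D \<in> cyclic_subgroups G. x \<in> D}"
proof -
  define \<D> where "\<D> = {D \<in> cyclic_subgroups G. x \<in> D}"
  define \<phi> where "\<phi> = (\<lambda>(D, i::nat). (\<lambda>z. z [^] (p ^ i)) ` D)"
  have p0: "0 < p" using p prime_gt_0_nat by blast
  \<comment> \<open>Maximality of \<open>a\<close> makes \<open>p ^ a\<close> the exact
    \<open>p\<close>-part of the order of \<open>d\<close>.\<close>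
  have ordd: "\<exists>m. ord d = p ^ a * m \<and> coprime p m \<and> 0 < m"
    if d: "d \<in> carrier G" and xd: "x \<in> generate G {d}" for d
  proof -
    obtain m where m: "ord d = p ^ a * m"
      using in_generate_ord_dvd[OF d xd] ordx by auto
    have "\<not> p dvd m"
      using max[OF d] m by auto
    moreover have "0 < m"
      using ord_pos[OF d] m by (cases m) auto
    ultimately show ?thesis
      using m p by (auto simp: prime_imp_coprime)
  qed
  have ordpow: "ord (d [^] (p ^ i)) = p ^ (a - i) * m"
    if "d \<in> carrier G" "ord d = p ^ a * m" "i \<le> a" for d i m
  proof -
    have "p ^ a = p ^ i * p ^ (a - i)"
      using that by (simp flip: power_add)
    then show ?thesis
      using that p0 by (simp add: ord_pow mult.assoc)
  qed
  \<comment> \<open>\<open>d\<close> is a product of powers of \<open>d [^] (p ^ a)\<close>, which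
    lies in the image since \<open>i \<le> a\<close>, and of \<open>d [^] m\<close>, which has order
    \<open>p ^ a\<close> and so lies in \<open>generate G {x}\<close>. Both factors are in
    \<open>generate G {e}\<close>.\<close>
  have sub: "generate G {d} \<subseteq> generate G {e}"
    if d: "d \<in> carrier G" "x \<in> generate G {d}" and e: "e \<in> carrier G" "x \<in> generate G {e}"
      and i: "i \<le> a" and de: "generate G {d [^] (p ^ i)} \<subseteq> generate G {e}" for d e i
  proof -
    obtain m where m: "ord d = p ^ a * m" "coprime p m" "0 < m"
      using ordd[OF d] by blast
    have pe: "d [^] (p ^ i) \<in> generate G {e}"
      using de generate_singleton_self by blast
    have "d [^] (p ^ a) = (d [^] (p ^ i)) [^] (p ^ (a - i))"
      using d i by (simp add: nat_pow_pow flip: power_add)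
    then have 1: "d [^] (p ^ a) \<in> generate G {e}"
      using nat_pow_in_generate[OF e(1) pe] by simp
    have "d [^] m \<in> generate G {x}"
    proof (rule in_generate_if_ord_dvd[OF d(1) _ d(2)])
      show "d [^] m \<in> generate G {d}"
        by (rule nat_pow_in_generate[OF d(1) generate_singleton_self])
      show "ord (d [^] m) dvd ord x"
        using d m by (simp add: ord_pow ordx)
    qed
    then have 2: "d [^] m \<in> generate G {e}"
      using generate_singleton_mono[OF e] by blast
    have "coprime (p ^ a) m" using m by simp
    then obtain u v :: int where uv: "u * int (p ^ a) + v * int m = 1"
      by (metis bezout_int coprime_iff_gcd_eq_1 coprime_int_iff)
    have "d = d [^] (u * int (p ^ a) + v * int m)"
      using d by (simp only: uv int_pow_1)
    also have "\<dots> = (d [^] (p ^ a)) [^] u \<otimes> (d [^] m) [^] v"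
      using d by (simp add: int_pow_mult mult.commute[of u] mult.commute[of v] flip: int_pow_pow int_pow_int)
    finally have "d \<in> generate G {e}"
      using 1 2 e generate_is_subgroup[of "{e}"]
      by (metis empty_subsetI generate.eng insert_subset subgroup_int_pow_closed)
    then show ?thesis
      by (rule generate_singleton_mono[OF e(1)])
  qed
  have "bij_betw \<phi> (\<D> \<times> {..a}) (cyclic_subgroups G)"
    unfolding bij_betw_def
  proof (intro conjI inj_onI equalityI subsetI)
    fix u v assume "u \<in> \<D> \<times> {..a}" "v \<in> \<D> \<times> {..a}" "\<phi> u = \<phi> v"
    then obtain D i E j where uv: "u = (D, i)" "v = (E, j)"
      and D: "D \<in> \<D>" "i \<le> a" and E: "E \<in> \<D>" "j \<le> a" and eq: "\<phi> (D, i) = \<phi> (E, j)"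
      by (cases u, cases v) auto
    obtain d where d: "d \<in> carrier G" "D = generate G {d}" "x \<in> generate G {d}"
      using D(1) by (auto simp: \<D>_def cyclic_subgroups_eq)
    obtain e where e: "e \<in> carrier G" "E = generate G {e}" "x \<in> generate G {e}"
      using E(1) by (auto simp: \<D>_def cyclic_subgroups_eq)
    have eq': "generate G {d [^] (p ^ i)} = generate G {e [^] (p ^ j)}"
      using eq d e by (simp add: \<phi>_def pow_image_generate)
    have pow_sub: "generate G {z [^] (k::nat)} \<subseteq> generate G {z}" if "z \<in> carrier G" for z k
      using that by (intro generate_singleton_mono nat_pow_in_generate generate_singleton_self)
    have "D \<subseteq> E"
      using sub[OF d(1,3) e(1,3) D(2)] pow_sub[OF e(1)] eq' d e by auto
    moreover have "E \<subseteq> D"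
      using sub[OF e(1,3) d(1,3) E(2)] pow_sub[OF d(1)] eq' d e by auto
    ultimately have DE: "D = E" by blast
    \<comment> \<open>The two images have orders \<open>p ^ (a - i) * m\<close> and
      \<open>p ^ (a - j) * m\<close>, which forces \<open>i = j\<close>.\<close>
    obtain m where m: "ord d = p ^ a * m" "coprime p m" "0 < m"
      using ordd[OF d(1,3)] by blast
    have "ord e = ord d"
      using generate_pow_card[OF d(1)] generate_pow_card[OF e(1)] DE d e by simp
    then have "ord (e [^] (p ^ j)) = p ^ (a - j) * m"
      using ordpow[OF e(1) _ E(2)] m by simp
    moreover have "ord (d [^] (p ^ i)) = ord (e [^] (p ^ j))"
      using generate_pow_card[of "d [^] (p ^ i)"] generate_pow_card[of "e [^] (p ^ j)"] eq' d e by simp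
    ultimately have "p ^ (a - i) = p ^ (a - j)"
      using ordpow[OF d(1) m(1) D(2)] m(3) by simp
    then have "a - i = a - j"
      using p by (metis power_inject_exp prime_gt_1_nat)
    with DE D(2) E(2) show "u = v"
      by (auto simp: uv)
  next
    fix C assume "C \<in> \<phi> ` (\<D> \<times> {..a})"
    then obtain D i where D: "D \<in> \<D>" and C: "C = \<phi> (D, i)"
      by auto
    obtain d where d: "d \<in> carrier G" "D = generate G {d}"
      using D by (auto simp: \<D>_def cyclic_subgroups_eq)
    then show "C \<in> cyclic_subgroups G"
      by (auto simp: C \<phi>_def pow_image_generate cyclic_subgroups_eq)
  next
    fix C assume "C \<in> cyclic_subgroups G"
    then obtain c where c: "c \<in> carrier G" "C = generate G {c}"
      by (auto simp: cyclic_subgroups_eq)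
    \<comment> \<open>The preimage of \<open>C\<close> comes from a cyclic subgroup containing both
      \<open>x\<close> and \<open>c\<close>; the exponent is then read off from the order of
      \<open>c\<close>.\<close>
    obtain i :: nat where i: "x \<in> generate G {x [^] i \<otimes> c}"
      using gen[OF c(1)] by blast
    define d where "d = x [^] i \<otimes> c"
    have d: "d \<in> carrier G" "x \<in> generate G {d}"
      using x c i by (auto simp: d_def)
    interpret S: subgroup "generate G {d}" G
      using d by (intro generate_is_subgroup) auto
    have xi: "x [^] i \<in> generate G {d}"
      by (rule nat_pow_in_generate[OF d])
    have "c = inv (x [^] i) \<otimes> d"
      using x c by (simp add: d_def flip: m_assoc)
    also have "\<dots> \<in> generate G {d}"
      using xi generate_singleton_self by (intro S.m_closed S.m_inv_closed)
    finally have cd: "c \<in> generate G {d}" .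
    have comm: "x [^] i \<otimes> c = c \<otimes> x [^] i"
    proof -
      obtain k l :: nat where "x [^] i = d [^] k" "c = d [^] l"
        using xi cd d by (auto simp: generate_nat_pow)
      then show ?thesis
        using d by (simp add: nat_pow_mult add.commute)
    qed
    obtain m where m: "ord d = p ^ a * m" "coprime p m" "0 < m"
      using ordd[OF d] by blast
    \<comment> \<open>Both factors of \<open>d\<close> vanish in this power, so \<open>m\<close>
      divides \<open>ord c\<close>, and \<open>ord c\<close> differs from \<open>ord d\<close> only
      by a power of \<open>p\<close>.\<close>
    have "d [^] (p ^ a * ord c) = (x [^] i) [^] (p ^ a * ord c) \<otimes> c [^] (p ^ a * ord c)"
      unfolding d_def using x c by (intro pow_mult_distrib comm) auto
    also have "(x [^] i) [^] (p ^ a * ord c) = \<one>"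
      using x by (simp add: nat_pow_pow pow_eq_id ordx)
    also have "c [^] (p ^ a * ord c) = \<one>"
      using c by (simp add: pow_eq_id)
    finally have "p ^ a * m dvd p ^ a * ord c"
      using d m by (simp add: pow_eq_id)
    then have "m dvd ord c"
      using p0 by simp
    then obtain s where s: "ord c = m * s" by blast
    have "s dvd p ^ a"
      using in_generate_ord_dvd[OF d(1) cd] s m by (simp add: mult.commute)
    then obtain b where b: "b \<le> a" "s = p ^ b"
      using p divides_primepow_nat by blast
    have "ord (d [^] (p ^ (a - b))) = ord c"
      using ordpow[OF d(1) m(1), of "a - b"] b s by simp
    then have "C = generate G {d [^] (p ^ (a - b))}"
      using c generate_eq_if_ord_eq[OF d(1) cd nat_pow_in_generate[OF d(1) generate_singleton_self]]
      by simp
    then have "C = \<phi> (generate G {d}, a - b)"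
      using d by (simp add: \<phi>_def pow_image_generate)
    moreover have "generate G {d} \<in> \<D>"
      using d by (auto simp: \<D>_def cyclic_subgroups_eq)
    ultimately show "C \<in> \<phi> ` (\<D> \<times> {..a})"
      using b by auto
  qed
  then have "card (cyclic_subgroups G) = card (\<D> \<times> {..a})"
    by (metis bij_betw_same_card)
  then show ?thesis
    by (simp add: \<D>_def card_cartesian_product)
qed

end

section \<open>Bounding the order\<close>

context finite_group
begin

text \<open>A largest member \<open>D1\<close> and a member \<open>D2\<close> not contained in it are incomparable, so some
  product \<open>g h\<close> lies outside both and needs a third member; \<open>A\<close> is a fourth one.\<close>

lemma four_le_card_cover:
  assumes \<D>: "finite \<D>" "\<And>D. D \<in> \<D> \<Longrightarrow> subgroup D G" "\<And>D. D \<in> \<D> \<Longrightarrow> D \<noteq> carrier G"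
    and cover: "carrier G \<subseteq> \<Union>\<D>" and A: "A \<in> \<D>" "\<And>D. D \<in> \<D> \<Longrightarrow> A \<subseteq> D"
  shows "4 \<le> card \<D>"
proof -
  have sub: "D \<subseteq> carrier G" if "D \<in> \<D>" for D
    using \<D>(2)[OF that] by (rule subgroup.subset)
  have finD: "finite D" if "D \<in> \<D>" for D
    using sub[OF that] fin finite_subset by blast
  obtain D1 where D1: "D1 \<in> \<D>" and D1max: "\<And>D. D \<in> \<D> \<Longrightarrow> card D \<le> card D1"
    using \<D>(1) A(1) by (metis (mono_tags, lifting) empty_iff finite_imageI image_eqI image_is_empty Max_ge Max_in imageE)
  obtain h where h: "h \<in> carrier G" "h \<notin> D1"
    using D1 sub \<D>(3) by blast
  obtain D2 where D2: "D2 \<in> \<D>" "h \<in> D2"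
    using cover h by blast
  \<comment> \<open>Containment would be equality by the maximality of \<open>D1\<close>, but
    \<open>h\<close> separates the two.\<close>
  have "\<not> D1 \<subseteq> D2"
    using D1max[OF D2(1)] finD[OF D2(1)] h D2 by (metis card_seteq)
  then obtain g where g: "g \<in> D1" "g \<notin> D2" by blast
  have gc: "g \<in> carrier G"
    using g D1 sub by blast
  interpret D1: subgroup D1 G using D1 by (rule \<D>(2))
  interpret D2: subgroup D2 G using D2(1) by (rule \<D>(2))
  have "g \<otimes> h \<notin> D1"
  proof
    assume "g \<otimes> h \<in> D1"
    then have "inv g \<otimes> (g \<otimes> h) \<in> D1" using g by blast
    then show False using h gc by (simp flip: m_assoc)
  qed
  moreover have "g \<otimes> h \<notin> D2"
  proof
    assume "g \<otimes> h \<in> D2"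
    then have "g \<otimes> h \<otimes> inv h \<in> D2" using D2 by blast
    then show False using g gc h by (simp add: m_assoc)
  qed
  moreover obtain D3 where "D3 \<in> \<D>" "g \<otimes> h \<in> D3"
    using cover h gc by (meson UnionE m_closed subsetD)
  \<comment> \<open>\<open>A\<close> misses \<open>g\<close>, \<open>h\<close> and
    \<open>g \<otimes> h\<close>, so it differs from \<open>D1\<close>, \<open>D2\<close> and
    \<open>D3\<close>.\<close>
  moreover have "A \<subseteq> D1" "A \<subseteq> D2"
    using A D1 D2 by blast+
  ultimately have "{A, D1, D2, D3} \<subseteq> \<D>" "card {A, D1, D2, D3} = 4"
    using A D1 D2 g h by (auto simp: card_insert_if)
  then show ?thesis
    using card_mono[OF \<D>(1)] by metis
qed

text \<open>Among the \<open>n + 1\<close> cyclic subgroups \<open>\<langle>x\<^sup>i g\<rangle>\<close>, \<open>i \<le> n\<close>, two coincide, so this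
  subgroup contains some \<open>x\<^sup>j\<close> with \<open>0 < j \<le> n < p\<close>, which generates \<open>\<langle>x\<rangle>\<close>.\<close>

lemma exists_pow_mult_generate:
  assumes p: "prime p" "card (cyclic_subgroups G) < p"
    and x: "x \<in> carrier G" "ord x = p ^ a" and g: "g \<in> carrier G"
  shows "\<exists>i::nat. x \<in> generate G {x [^] i \<otimes> g}"
proof -
  define n where "n = card (cyclic_subgroups G)"
  define f where "f = (\<lambda>i::nat. generate G {x [^] i \<otimes> g})"
  have "f ` {..n} \<subseteq> cyclic_subgroups G"
    using x g by (auto simp: f_def cyclic_subgroups_eq)
  then have "card (f ` {..n}) < card {..n}"
    using card_mono[OF finite_cyclic_subgroups, of "f ` {..n}"] by (simp add: n_def)
  then have "\<not> inj_on f {..n}"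
    by (rule pigeonhole)
  then obtain i j where ij: "i < j" "j \<le> n" "f i = f j"
    unfolding inj_on_def by (metis atMost_iff linorder_neqE_nat)
  define S where "S = generate G {x [^] i \<otimes> g}"
  interpret S: subgroup S G
    unfolding S_def using x g by (intro generate_is_subgroup) auto
  have 1: "x [^] i \<otimes> g \<in> S"
    by (simp add: S_def generate_singleton_self)
  have 2: "x [^] j \<otimes> g \<in> S"
    using ij(3) generate_singleton_self[of "x [^] j \<otimes> g"] by (simp add: S_def f_def)
  have j: "x [^] (j - i) \<otimes> x [^] i = x [^] j"
    using x ij by (simp add: nat_pow_mult)
  have "x [^] (j - i) \<otimes> (x [^] i \<otimes> g) = x [^] j \<otimes> g"
    using x g by (simp flip: m_assoc add: j)
  then have "x [^] (j - i) = x [^] j \<otimes> g \<otimes> inv (x [^] i \<otimes> g)"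
    using x g by (intro iffD2[OF inv_solve_right]) auto
  also have "\<dots> \<in> S"
    using 1 2 by blast
  finally have S: "x [^] (j - i) \<in> S" .
  have "\<not> p dvd j - i"
    using ij p by (auto simp: n_def dest!: dvd_imp_le)
  then have "coprime (j - i) (ord x)"
    using p x(2) by (simp add: prime_imp_coprime coprime_commute)
  then have "x \<in> generate G {x [^] (j - i)}"
    using x pow_generate_coprime by blast
  also have "\<dots> \<subseteq> S"
    unfolding S_def using S x g by (intro generate_singleton_mono) (auto simp: S_def)
  finally show ?thesis
    by (auto simp: S_def)
qed

text \<open>The cyclic subgroups containing an element \<open>x\<close> of maximal
  \<open>p\<close>-power order cover the group, are proper because the group is not cyclic, and all
  contain \<open>generate G {x}\<close>. Their number is the required \<open>k\<close>.\<close>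

lemma large_prime_divisor_imp_proper_divisor:
  assumes nc: "\<not> cyclic_group G" and p: "prime p" "card (cyclic_subgroups G) < p"
    and g: "g \<in> carrier G" "p dvd ord g"
  shows "\<exists>k. k dvd card (cyclic_subgroups G) \<and> k < card (cyclic_subgroups G) \<and> 4 \<le> k"
proof -
  \<comment> \<open>The largest exponent of \<open>p\<close> in the order of an element; a power of
    an element attaining it has order exactly \<open>p ^ a\<close>.\<close>
  define a where "a = Max ((\<lambda>y. multiplicity p (ord y)) ` carrier G)"
  have amax: "multiplicity p (ord y) \<le> a" if "y \<in> carrier G" for y
    using that by (simp add: a_def)
  have "a \<in> (\<lambda>y. multiplicity p (ord y)) ` carrier G"
    unfolding a_def using g by (intro Max_in) auto
  then obtain y where y: "y \<in> carrier G" "a = multiplicity p (ord y)"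
    by blast
  have pu: "\<not> is_unit p" using p by auto
  obtain m where m: "ord y = p ^ a * m"
    using multiplicity_dvd[of p "ord y"] y(2) by auto
  have m0: "m \<noteq> 0" using m ord_pos[OF y(1)] by (cases m) auto
  define x where "x = y [^] m"
  have x: "x \<in> carrier G" "ord x = p ^ a"
    using y m m0 by (auto simp: x_def ord_pow)
  have max: "\<not> p ^ Suc a dvd ord z" if "z \<in> carrier G" for z
    using amax[OF that] ord_pos[OF that] pu by (simp add: power_dvd_iff_le_multiplicity del: power_Suc)
  have a1: "1 \<le> a"
    using max[OF g(1)] g(2) by (cases a) auto
  define \<D> where "\<D> = {D \<in> cyclic_subgroups G. x \<in> D}"
  have gen: "\<exists>i::nat. x \<in> generate G {x [^] i \<otimes> z}" if "z \<in> carrier G" for z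
    using exists_pow_mult_generate[OF p x that] .
  have eq: "card (cyclic_subgroups G) = Suc a * card \<D>"
    unfolding \<D>_def using card_cyclic_subgroups_split[OF p(1) x gen max] .
  have "4 \<le> card \<D>"
  proof (rule four_le_card_cover[where A = "generate G {x}"])
    show "finite \<D>"
      by (simp add: \<D>_def finite_cyclic_subgroups)
    show "subgroup D G" if "D \<in> \<D>" for D
      using that by (simp add: \<D>_def cyclic_subgroups_def)
    show "D \<noteq> carrier G" if "D \<in> \<D>" for D
      using that nc by (auto simp: \<D>_def cyclic_subgroups_eq cyclic_group_iff_generate)
    show "carrier G \<subseteq> \<Union>\<D>"
    proof
      fix z assume z: "z \<in> carrier G"
      then obtain i :: nat where i: "x \<in> generate G {x [^] i \<otimes> z}"
        using gen by blast
      define D where "D = generate G {x [^] i \<otimes> z}"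
      interpret D: subgroup D G
        unfolding D_def using x z by (intro generate_is_subgroup) auto
      have "x [^] i \<in> D"
        using nat_pow_in_generate[OF _ i] x z by (simp add: D_def)
      moreover have "x [^] i \<otimes> z \<in> D"
        by (simp add: D_def generate_singleton_self)
      ultimately have "inv (x [^] i) \<otimes> (x [^] i \<otimes> z) \<in> D"
        by blast
      then have "z \<in> D"
        using x z by (simp flip: m_assoc)
      moreover have "D \<in> \<D>"
        using i x z by (auto simp: \<D>_def D_def cyclic_subgroups_eq)
      ultimately show "z \<in> \<Union>\<D>" by blast
    qed
    show "generate G {x} \<in> \<D>"
      using x generate_singleton_self by (auto simp: \<D>_def cyclic_subgroups_eq)
    show "generate G {x} \<subseteq> D" if "D \<in> \<D>" for D
      using that generate_singleton_mono by (auto simp: \<D>_def cyclic_subgroups_eq)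
  qed
  \<comment> \<open>As \<open>a \<ge> 1\<close>, the factor \<open>Suc a\<close> is at least 2 and
    \<open>card \<D>\<close> is a proper divisor.\<close>
  with eq a1 show ?thesis
    by (intro exI[of _ "card \<D>"]) auto
qed

text \<open>With \<open>b\<close> the multiplicity, the powers \<open>g [^] (p ^ i)\<close> for
  \<open>i \<le> b\<close> generate \<open>b + 1\<close> subgroups of different orders.\<close>

lemma multiplicity_ord_less:
  assumes p: "prime p" and g: "g \<in> carrier G"
  shows "multiplicity p (ord g) < card (cyclic_subgroups G)"
proof -
  define b where "b = multiplicity p (ord g)"
  obtain m where m: "ord g = p ^ b * m"
    using multiplicity_dvd[of p "ord g"] by (auto simp: b_def)
  have m0: "m \<noteq> 0" using m ord_pos[OF g] by (cases m) auto
  have p1: "1 < p" using p prime_gt_1_nat by blast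
  define f where "f = (\<lambda>i. generate G {g [^] (p ^ i)})"
  have "card (f i) = p ^ (b - i) * m" if "i \<le> b" for i
  proof -
    have "p ^ b = p ^ i * p ^ (b - i)"
      using that by (simp flip: power_add)
    then have "ord (g [^] (p ^ i)) = p ^ (b - i) * m"
      using g m p1 by (simp add: ord_pow mult.assoc)
    then show ?thesis
      using generate_pow_card[of "g [^] (p ^ i)"] g by (simp add: f_def)
  qed
  then have "inj_on f {..b}"
    using m0 p1 by (intro inj_onI) (metis atMost_iff diff_diff_cancel mult_cancel2 power_inject_exp)
  then have "card {..b} \<le> card (cyclic_subgroups G)"
    using g by (intro card_inj_on_le[of f]) (auto simp: f_def cyclic_subgroups_eq)
  then show ?thesis
    by (simp add: b_def)
qed

text \<open>The primes dividing the order of an element are at most \<open>n\<close> and occur with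
  exponent below \<open>n\<close>, so the order divides \<open>fact n ^ n\<close>. The group is the
  union of its \<open>n\<close> cyclic subgroups.\<close>

lemma card_carrier_le:
  assumes "\<not> cyclic_group G" and n: "n = card (cyclic_subgroups G)"
    and divs: "\<And>k. k dvd n \<Longrightarrow> k < n \<Longrightarrow> k < 4"
  shows "card (carrier G) \<le> n * fact n ^ n"
proof -
  have ord_le: "ord g \<le> fact n ^ n" if g: "g \<in> carrier G" for g
  proof (rule dvd_imp_le)
    show "ord g dvd fact n ^ n"
    proof (rule multiplicity_le_imp_dvd)
      show "ord g \<noteq> 0" using ord_pos[OF g] by simp
      fix p :: nat assume p: "prime p"
      show "multiplicity p (ord g) \<le> multiplicity p (fact n ^ n)"
      proof (cases "p dvd ord g")
        case True
        then have "\<not> n < p"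
          using large_prime_divisor_imp_proper_divisor[OF assms(1) p _ g] divs n by (metis not_le)
        then have "p dvd fact n"
          using p by (simp add: prime_dvd_fact_iff)
        then have "1 \<le> multiplicity p (fact n :: nat)"
          using p by (intro multiplicity_geI) auto
        then have "n \<le> multiplicity p (fact n ^ n :: nat)"
          using p by (simp add: prime_elem_multiplicity_power_distrib)
        then show ?thesis
          using multiplicity_ord_less[OF p g] n by simp
      qed (simp add: not_dvd_imp_multiplicity_0)
    qed
  qed simp
  have "carrier G \<subseteq> \<Union>(cyclic_subgroups G)"
    using generate_singleton_self by (force simp: cyclic_subgroups_eq)
  then have "card (carrier G) \<le> card (\<Union>(cyclic_subgroups G))"
    using finite_subset[OF generate_singleton_subset fin] finite_cyclic_subgroups
    by (intro card_mono finite_Union) (auto simp: cyclic_subgroups_eq)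
  also have "\<dots> \<le> (\<Sum>D\<in>cyclic_subgroups G. card D)"
    by (rule card_Union_le_sum_card)
  also have "\<dots> \<le> (\<Sum>D\<in>cyclic_subgroups G. fact n ^ n)"
    using ord_le generate_pow_card by (intro sum_mono) (auto simp: cyclic_subgroups_eq)
  finally show ?thesis
    by (simp add: n)
qed

end

section \<open>Finitely many isomorphism classes from bounded order\<close>

lemma noncyclic_group_imp_finite_group: "G \<in> noncyclic_groups n \<Longrightarrow> finite_group G"
  by (simp add: noncyclic_groups_def finite_group_def finite_group_axioms_def)

text \<open>Transporting the multiplication table to \<open>{..<card (carrier G)}\<close> gives an
  invariant that takes finitely many values and determines the isomorphism class.\<close>

lemma finite_quotient_if_bounded:
  assumes bound: "\<And>G. G \<in> noncyclic_groups n \<Longrightarrow> card (carrier G) \<le> b"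
  shows "finite (noncyclic_groups n // noncyclic_group_iso n)"
proof -
  \<comment> \<open>The labelling is an arbitrary choice, so isomorphic groups may get different
    tables; only the converse, that equal tables give isomorphic groups, is used.\<close>
  define e where "e = (\<lambda>G :: nat monoid. SOME f. bij_betw f (carrier G) {..<card (carrier G)})"
  define t where "t = (\<lambda>G :: nat monoid. (\<lambda>(x, y). (e G x, e G y, e G (x \<otimes>\<^bsub>G\<^esub> y))) ` (carrier G \<times> carrier G))"
  have e: "bij_betw (e G) (carrier G) {..<card (carrier G)}" if "G \<in> noncyclic_groups n" for G
  proof -
    have "finite (carrier G)" using that by (simp add: noncyclic_groups_def)
    then show ?thesis
      unfolding e_def by (rule someI_ex[OF ex_bij_betw_finite_nat[unfolded atLeast0LessThan]])
  qed
  have iso: "(G, H) \<in> noncyclic_group_iso n"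
    if G: "G \<in> noncyclic_groups n" and H: "H \<in> noncyclic_groups n"
      and "card (carrier G) = card (carrier H)" "t G = t H" for G H
  proof -
    interpret G: group G using G by (simp add: noncyclic_groups_def)
    interpret H: group H using H by (simp add: noncyclic_groups_def)
    define h where "h = inv_into (carrier H) (e H) \<circ> e G"
    have bij: "bij_betw h (carrier G) (carrier H)"
      unfolding h_def using e[OF G] e[OF H] that(3)
      by (metis bij_betw_inv_into bij_betw_trans)
    have eh: "e H (h x) = e G x" if "x \<in> carrier G" for x
      using that e[OF G] e[OF H] \<open>card (carrier G) = _\<close>
      by (auto simp: h_def bij_betw_def intro!: f_inv_into_f)
    have hc: "h x \<in> carrier H" if "x \<in> carrier G" for x
      using bij that by (auto simp: bij_betw_def)
    have injH: "u = v" if "e H u = e H v" "u \<in> carrier H" "v \<in> carrier H" for u v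
      using e[OF H] that by (auto simp: bij_betw_def inj_on_def)
    have "h (x \<otimes>\<^bsub>G\<^esub> y) = h x \<otimes>\<^bsub>H\<^esub> h y" if x: "x \<in> carrier G" and y: "y \<in> carrier G" for x y
    proof -
      have "(e G x, e G y, e G (x \<otimes>\<^bsub>G\<^esub> y)) \<in> t G"
        using x y by (force simp: t_def)
      then have "(e H (h x), e H (h y), e H (h (x \<otimes>\<^bsub>G\<^esub> y))) \<in> t H"
        using x y \<open>t G = t H\<close> by (simp add: eh)
      then obtain u v where uv: "u \<in> carrier H" "v \<in> carrier H" "e H (h x) = e H u" "e H (h y) = e H v"
        "e H (h (x \<otimes>\<^bsub>G\<^esub> y)) = e H (u \<otimes>\<^bsub>H\<^esub> v)"
        by (auto simp: t_def)
      then have "h x = u" "h y = v"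
        using hc x y injH by blast+
      then show ?thesis
        using uv hc x y injH by blast
    qed
    then have "h \<in> iso G H"
      using bij hc by (auto simp: iso_def hom_def)
    then show ?thesis
      using G H by (auto simp: noncyclic_group_iso_def is_iso_def)
  qed
  define T where "T = (\<lambda>G. (card (carrier G), t G))"
  have "T ` noncyclic_groups n \<subseteq> {..b} \<times> Pow ({..<b} \<times> {..<b} \<times> {..<b})"
  proof (intro image_subsetI)
    fix G assume G: "G \<in> noncyclic_groups n"
    interpret G: group G using G by (simp add: noncyclic_groups_def)
    have "e G x < b" if "x \<in> carrier G" for x
      using bij_betw_apply[OF e[OF G] that] bound[OF G] by simp
    then show "T G \<in> {..b} \<times> Pow ({..<b} \<times> {..<b} \<times> {..<b})"
      using bound[OF G] by (auto simp: T_def t_def)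
  qed
  then have fin: "finite (T ` noncyclic_groups n)"
    by (rule finite_subset) auto
  \<comment> \<open>\<open>F\<close> recovers a class from a value of \<open>T\<close> through a
    chosen group with that value, so there are at most as many classes as values.\<close>
  define F where "F = (\<lambda>v. noncyclic_group_iso n `` {inv_into (noncyclic_groups n) T v})"
  have "noncyclic_group_iso n `` {G} = F (T G)" if G: "G \<in> noncyclic_groups n" for G
  proof -
    define H where "H = inv_into (noncyclic_groups n) T (T G)"
    have "H \<in> noncyclic_groups n" "T H = T G"
      using G by (auto simp: H_def inv_into_into f_inv_into_f)
    then have "(G, H) \<in> noncyclic_group_iso n"
      using iso[OF G] by (simp add: T_def)
    then show ?thesis
      unfolding F_def H_def[symmetric] by (rule equiv_class_eq[OF equiv_noncyclic_group_iso])
  qed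
  then have "noncyclic_groups n // noncyclic_group_iso n \<subseteq> F ` T ` noncyclic_groups n"
    by (auto simp: quotient_def)
  then show ?thesis
    using fin by (meson finite_imageI finite_subset)
qed

section \<open>Coprime direct products\<close>

context finite_group
begin

lemma nat_pow_cong_ord:
  assumes "x \<in> carrier G" "[k = l] (mod ord x)"
  shows "x [^] (k::nat) = x [^] (l::nat)"
proof -
  have "int (ord x) dvd int l - int k"
    using assms(2) by (metis cong_iff_dvd_diff cong_int_iff cong_sym)
  then show ?thesis
    using assms(1) int_pow_eq[of x "int k" "int l"] by (simp add: int_pow_int)
qed

text \<open>A cyclic group has exactly one subgroup for each divisor of its order, so
  \<open>card\<close> is the bijection.\<close>

lemma card_cyclic_subgroups_below:
  assumes z: "z \<in> carrier G"
  shows "card {C \<in> cyclic_subgroups G. C \<subseteq> generate G {z}} = card {d. d dvd ord z}"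
proof (rule bij_betw_same_card[of card], rule bij_betw_imageI)
  show "inj_on card {C \<in> cyclic_subgroups G. C \<subseteq> generate G {z}}"
  proof (rule inj_onI)
    fix C D
    assume C: "C \<in> {C \<in> cyclic_subgroups G. C \<subseteq> generate G {z}}"
      and D: "D \<in> {C \<in> cyclic_subgroups G. C \<subseteq> generate G {z}}" and eq: "card C = card D"
    obtain c where c: "c \<in> carrier G" "C = generate G {c}" "c \<in> generate G {z}"
      using C generate_singleton_self by (auto simp: cyclic_subgroups_eq)
    obtain d where d: "d \<in> carrier G" "D = generate G {d}" "d \<in> generate G {z}"
      using D generate_singleton_self by (auto simp: cyclic_subgroups_eq)
    have "ord c = ord d"
      using eq generate_pow_card[OF c(1)] generate_pow_card[OF d(1)] c(2) d(2) by simp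
    then show "C = D"
      using generate_eq_if_ord_eq[OF z c(3) d(3)] c(2) d(2) by simp
  qed
  show "card ` {C \<in> cyclic_subgroups G. C \<subseteq> generate G {z}} = {d. d dvd ord z}"
  proof (intro equalityI subsetI)
    fix d assume "d \<in> card ` {C \<in> cyclic_subgroups G. C \<subseteq> generate G {z}}"
    then obtain c where "c \<in> carrier G" "generate G {c} \<subseteq> generate G {z}" "d = card (generate G {c})"
      by (auto simp: cyclic_subgroups_eq)
    then show "d \<in> {d. d dvd ord z}"
      using in_generate_ord_dvd[OF z, of c] generate_singleton_self[of c] generate_pow_card[of c]
      by (metis mem_Collect_eq subsetD)
  next
    fix d assume "d \<in> {d. d dvd ord z}"
    then obtain e where e: "ord z = d * e" by auto
    then have "e \<noteq> 0" using ord_pos[OF z] by auto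
    then have "ord (z [^] e) = d"
      using e z by (simp add: ord_pow)
    then have "d = card (generate G {z [^] e})"
      using generate_pow_card[of "z [^] e"] z by simp
    moreover have "generate G {z [^] e} \<subseteq> generate G {z}"
      using z by (intro generate_singleton_mono nat_pow_in_generate generate_singleton_self)
    ultimately show "d \<in> card ` {C \<in> cyclic_subgroups G. C \<subseteq> generate G {z}}"
      using z by (auto simp: cyclic_subgroups_eq)
  qed
qed

lemma generate_involution:
  assumes "x \<in> carrier G" "x \<otimes> x = \<one>"
  shows "generate G {x} = {\<one>, x}"
proof -
  have *: "x [^] (k::nat) = (if even k then \<one> else x)" for k
    using assms by (induction k) auto
  show ?thesis
  proof (intro equalityI subsetI)
    fix y assume "y \<in> generate G {x}"
    then obtain k :: nat where "y = x [^] k"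
      using assms(1) by (auto simp: generate_nat_pow)
    then show "y \<in> {\<one>, x}"
      using *[of k] by simp
  qed (auto intro: generate.one generate_singleton_self)
qed

text \<open>Each \<open>x\<close> generates \<open>{\<one>, x}\<close>, and this set determines
  \<open>x\<close>.\<close>

lemma card_cyclic_subgroups_exponent_two:
  assumes "\<And>x. x \<in> carrier G \<Longrightarrow> x \<otimes> x = \<one>"
  shows "card (cyclic_subgroups G) = card (carrier G)"
proof -
  have "inj_on (\<lambda>x. generate G {x}) (carrier G)"
    using assms generate_involution by (intro inj_onI) (auto simp: doubleton_eq_iff)
  then show ?thesis
    by (simp add: cyclic_subgroups_eq card_image)
qed

end

lemma finite_group_DirProd:
  "finite_group G \<Longrightarrow> finite_group H \<Longrightarrow> finite_group (G \<times>\<times> H)"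
  by (simp add: finite_group_def finite_group_axioms_def DirProd_group)

lemma nat_pow_DirProd: "(x, y) [^]\<^bsub>G \<times>\<times> H\<^esub> (k::nat) = (x [^]\<^bsub>G\<^esub> k, y [^]\<^bsub>H\<^esub> k)"
  by (induction k) (auto simp: nat_pow_def)

text \<open>The Chinese remainder theorem yields one exponent that realises prescribed powers of
  \<open>x\<close> and \<open>y\<close> simultaneously.\<close>

lemma generate_DirProd_coprime:
  assumes "finite_group G" "finite_group H" and cop: "coprime (order G) (order H)"
    and x: "x \<in> carrier G" and y: "y \<in> carrier H"
  shows "generate (G \<times>\<times> H) {(x, y)} = generate G {x} \<times> generate H {y}"
proof -
  interpret G: finite_group G by fact
  interpret H: finite_group H by fact
  interpret GH: finite_group "G \<times>\<times> H"
    using assms finite_group_DirProd by blast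
  have cop': "coprime (G.ord x) (H.ord y)"
    using cop G.ord_dvd_group_order[OF x] H.ord_dvd_group_order[OF y] coprime_divisors by blast
  have "(x [^]\<^bsub>G\<^esub> k, y [^]\<^bsub>H\<^esub> l) \<in> range (\<lambda>t::nat. (x [^]\<^bsub>G\<^esub> t, y [^]\<^bsub>H\<^esub> t))" for k l :: nat
  proof -
    obtain t where t: "[t = k] (mod G.ord x)" "[t = l] (mod H.ord y)"
      using binary_chinese_remainder_nat[OF cop'] by blast
    have "x [^]\<^bsub>G\<^esub> t = x [^]\<^bsub>G\<^esub> k" "y [^]\<^bsub>H\<^esub> t = y [^]\<^bsub>H\<^esub> l"
      using G.nat_pow_cong_ord[OF x t(1)] H.nat_pow_cong_ord[OF y t(2)] by blast+
    then show ?thesis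
      using rangeI[of "\<lambda>t::nat. (x [^]\<^bsub>G\<^esub> t, y [^]\<^bsub>H\<^esub> t)" t] by simp
  qed
  then show ?thesis
    using x y by (auto simp: GH.generate_nat_pow G.generate_nat_pow H.generate_nat_pow nat_pow_DirProd)
qed

text \<open>The cyclic subgroups of the product are the rectangles \<open>A \<times> B\<close>; both
  sides are nonempty, so a rectangle determines them.\<close>

lemma card_cyclic_subgroups_DirProd_coprime:
  assumes "finite_group G" "finite_group H" and cop: "coprime (order G) (order H)"
  shows "card (cyclic_subgroups (G \<times>\<times> H)) = card (cyclic_subgroups G) * card (cyclic_subgroups H)"
proof -
  interpret G: finite_group G by fact
  interpret H: finite_group H by fact
  interpret GH: finite_group "G \<times>\<times> H"
    using assms finite_group_DirProd by blast
  have "cyclic_subgroups (G \<times>\<times> H) = (\<lambda>(A, B). A \<times> B) ` (cyclic_subgroups G \<times> cyclic_subgroups H)"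
    using generate_DirProd_coprime[OF assms]
    by (force simp: GH.cyclic_subgroups_eq G.cyclic_subgroups_eq H.cyclic_subgroups_eq image_iff)
  moreover have "inj_on (\<lambda>(A, B). A \<times> B) (cyclic_subgroups G \<times> cyclic_subgroups H)"
    using G.generate_singleton_self H.generate_singleton_self
    by (auto simp: inj_on_def G.cyclic_subgroups_eq H.cyclic_subgroups_eq times_eq_iff)
  ultimately show ?thesis
    by (simp add: card_image card_cartesian_product)
qed

lemma finite_group_integer_mod: "n \<noteq> 0 \<Longrightarrow> finite_group (integer_mod_group n)"
  by (simp add: finite_group_def finite_group_axioms_def carrier_integer_mod_group)

lemma order_integer_mod_group: "n \<noteq> 0 \<Longrightarrow> order (integer_mod_group n) = n"
  by (simp add: order_def carrier_integer_mod_group)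

lemma card_cyclic_subgroups_integer_mod_group_prime_power:
  assumes p: "prime (p::nat)"
  shows "card (cyclic_subgroups (integer_mod_group (p ^ a))) = Suc a"
proof -
  define n where "n = p ^ a"
  have n: "n \<noteq> 0" using p by (auto simp: n_def)
  interpret finite_group "integer_mod_group n"
    using n by (rule finite_group_integer_mod)
  \<comment> \<open>The reduction keeps \<open>z\<close> in the carrier when \<open>a = 0\<close>,
    where the group is trivial.\<close>
  define z where "z = 1 mod int n"
  have z: "z \<in> carrier (integer_mod_group n)"
    using n by (simp add: z_def carrier_integer_mod_group)
  have "w \<in> generate (integer_mod_group n) {z}" if w: "w \<in> carrier (integer_mod_group n)" for w
  proof -
    have "w = z [^]\<^bsub>integer_mod_group n\<^esub> nat w"
      using w n by (simp add: z_def carrier_integer_mod_group mod_mult_right_eq)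
    then show ?thesis
      unfolding generate_nat_pow[OF z] by (rule image_eqI) simp
  qed
  then have gen: "generate (integer_mod_group n) {z} = carrier (integer_mod_group n)"
    using generate_singleton_subset[OF z] by blast
  then have "ord z = n"
    using generate_pow_card[OF z] n by (simp add: carrier_integer_mod_group)
  moreover have "{C \<in> cyclic_subgroups (integer_mod_group n). C \<subseteq> generate (integer_mod_group n) {z}}
      = cyclic_subgroups (integer_mod_group n)"
    using generate_singleton_subset by (auto simp: gen cyclic_subgroups_eq)
  ultimately have "card (cyclic_subgroups (integer_mod_group n)) = card {d. d dvd n}"
    using card_cyclic_subgroups_below[OF z] by simp
  also have "{d. d dvd n} = (\<lambda>i. p ^ i) ` {..a}"
    using p by (auto simp: n_def divides_primepow_nat)
  also have "card \<dots> = Suc a"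
    using p by (subst card_image) (auto intro!: inj_onI dest: prime_gt_1_nat)
  finally show ?thesis by (simp add: n_def)
qed

section \<open>Infinite families from one noncyclic group\<close>

text \<open>Finitely many classes would bound the orders of all groups counted, but products of
  \<open>H\<close> with cyclic groups of large prime power order have unbounded order.\<close>

lemma not_in_scrB_if_noncyclic_group:
  fixes H :: "'a monoid"
  assumes H: "finite_group H" and nc: "\<not> cyclic_group H"
    and n: "n = card (cyclic_subgroups H) * j" and j: "2 \<le> j"
  shows "n \<notin> scrB"
proof
  assume "n \<in> scrB"
  then have fin: "finite (noncyclic_groups n // noncyclic_group_iso n)"
    by (simp add: scrB_def)
  interpret H: finite_group H by fact
  have card_eq: "card (carrier G) = card (carrier K)" if "(G, K) \<in> noncyclic_group_iso n" for G K
    using that iso_same_card by (auto simp: noncyclic_group_iso_def)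
  \<comment> \<open>Isomorphic groups have equal order, so the chosen representative is
    immaterial.\<close>
  define c where "c = (\<lambda>X :: nat monoid set. card (carrier (SOME G. G \<in> X)))"
  have "card (carrier G) \<in> c ` (noncyclic_groups n // noncyclic_group_iso n)"
    if G: "G \<in> noncyclic_groups n" for G
  proof (rule image_eqI)
    show "noncyclic_group_iso n `` {G} \<in> noncyclic_groups n // noncyclic_group_iso n"
      using G by (rule quotientI)
    have "G \<in> noncyclic_group_iso n `` {G}"
      using G equiv_class_self[OF equiv_noncyclic_group_iso] by blast
    then have "(SOME K. K \<in> noncyclic_group_iso n `` {G}) \<in> noncyclic_group_iso n `` {G}"
      by (rule someI)
    then show "card (carrier G) = c (noncyclic_group_iso n `` {G})"
      unfolding c_def by (intro card_eq) simp
  qed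
  then have "finite ((\<lambda>G :: nat monoid. card (carrier G)) ` noncyclic_groups n)"
    using fin by (meson finite_imageI finite_subset image_subsetI)
  then obtain b where b: "\<And>G. G \<in> noncyclic_groups n \<Longrightarrow> card (carrier G) \<le> b"
    by (metis (no_types, lifting) finite_nat_set_iff_bounded_le imageI)
  \<comment> \<open>Exceeding \<open>order H\<close> gives coprimality; exceeding \<open>b\<close>
    gives the contradiction.\<close>
  obtain r where r: "prime r" "order H + b < r"
    using bigger_prime by blast
  \<comment> \<open>The exponent \<open>j - 1\<close> gives \<open>j\<close> cyclic subgroups; it is
    positive since \<open>j \<ge> 2\<close>, so \<open>order C\<close> is at least
    \<open>r\<close>.\<close>
  define C where "C = integer_mod_group (r ^ (j - 1))"
  have r0: "r ^ (j - 1) \<noteq> 0" using r by simp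
  have C: "finite_group C" "order C = r ^ (j - 1)"
    unfolding C_def using finite_group_integer_mod[OF r0] order_integer_mod_group[OF r0] by auto
  have oH: "0 < order H"
    by (simp add: H.order_gt_0_iff_finite)
  have "\<not> r dvd order H"
    using oH r(2) by (auto dest!: dvd_imp_le)
  then have cop: "coprime (order H) (order C)"
    using r(1) by (simp add: C prime_imp_coprime coprime_commute)
  interpret HC: finite_group "H \<times>\<times> C"
    using H C finite_group_DirProd by blast
  have "\<not> cyclic_group (H \<times>\<times> C)"
  proof
    assume "cyclic_group (H \<times>\<times> C)"
    moreover have "fst \<in> epi (H \<times>\<times> C) H"
      using monoid.one_closed[OF group.is_monoid[OF finite_group.axioms(1)[OF C(1)]]]
      by (force simp: epi_def hom_def)
    ultimately show False
      using HC.cyclic_group_epimorphic_image H.group_axioms nc by blast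
  qed
  moreover have "card (cyclic_subgroups (H \<times>\<times> C)) = n"
    using card_cyclic_subgroups_DirProd_coprime[OF H C(1) cop]
      card_cyclic_subgroups_integer_mod_group_prime_power[OF r(1), of "j - 1"] j
    by (simp add: n C_def)
  ultimately obtain K where "K \<in> noncyclic_groups n" "H \<times>\<times> C \<cong> K"
    using noncyclic_groups_represented[OF HC.group_axioms HC.fin] by metis
  then have "card (carrier (H \<times>\<times> C)) \<le> b"
    using b iso_same_card by fastforce
  moreover have "card (carrier (H \<times>\<times> C)) = order H * r ^ (j - 1)"
    using C by (simp add: card_cartesian_product order_def)
  moreover have "r \<le> r ^ (j - 1)"
    using j prime_gt_1_nat[OF r(1)] power_increasing[of 1 "j - 1" r] by simp
  moreover have "r ^ (j - 1) \<le> order H * r ^ (j - 1)"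
    using oH by simp
  ultimately show False
    using r(2) by linarith
qed

section \<open>Noncyclic groups with few cyclic subgroups\<close>

text \<open>The semidirect product of \<open>\<int>/3\<close> by \<open>\<int>/2\<^sup>m\<close> in which the generator of \<open>\<int>/2\<^sup>m\<close> inverts
  \<open>\<int>/3\<close>; only for \<open>m \<ge> 1\<close> is the action well defined.\<close>

definition twisted :: "nat \<Rightarrow> (nat \<times> nat) monoid"
  where "twisted m = \<lparr>carrier = {..<3} \<times> {..<2 ^ m},
    monoid.mult = (\<lambda>(a, b) (c, d). ((a + (if even b then c else 2 * c)) mod 3, (b + d) mod 2 ^ m)),
    one = (0, 0)\<rparr>"

lemma even_mod_power_two: "1 \<le> m \<Longrightarrow> even (b mod 2 ^ m :: nat) \<longleftrightarrow> even b"
  by (simp add: dvd_mod_iff)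

text \<open>\<open>P\<close> and \<open>Q\<close> stand for evenness of the second coordinates of
  the first two factors, so \<open>P = Q\<close> is evenness of their sum. Doubling is inversion
  modulo 3, and doubling twice is the identity.\<close>

lemma twisted_assoc_fst:
  "((a + (if P then c else 2 * c)) mod 3 + (if P = Q then e else 2 * e)) mod 3 =
   (a + (if P then (c + (if Q then e else 2 * e)) mod 3 else 2 * ((c + (if Q then e else 2 * e)) mod 3))) mod (3::nat)"
proof -
  have "(a + 2 * c + e) mod 3 = (a + 2 * (c + 2 * e)) mod 3"
    by presburger
  moreover have "(a + 2 * (x mod 3)) mod 3 = (a + 2 * x) mod 3" for x
    by (metis mod_add_right_eq mod_mult_right_eq)
  ultimately show ?thesis
    by (cases P; cases Q; simp add: mod_simps add.assoc)
qed

lemma finite_group_twisted: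
  assumes m: "1 \<le> m"
  shows "finite_group (twisted m)"
proof (intro finite_group.intro finite_group_axioms.intro groupI)
  fix x y z
  assume "x \<in> carrier (twisted m)" "y \<in> carrier (twisted m)" "z \<in> carrier (twisted m)"
  then show "x \<otimes>\<^bsub>twisted m\<^esub> y \<otimes>\<^bsub>twisted m\<^esub> z = x \<otimes>\<^bsub>twisted m\<^esub> (y \<otimes>\<^bsub>twisted m\<^esub> z)"
    using m twisted_assoc_fst[of "fst x" "even (snd x)" "fst y" "even (snd y)" "fst z"]
    by (simp add: twisted_def case_prod_beta even_mod_power_two mod_simps add.assoc)
next
  fix x assume x: "x \<in> carrier (twisted m)"
  obtain a b where ab: "x = (a, b)" by (cases x)
  \<comment> \<open>For odd \<open>b\<close> the element \<open>a\<close> is its own partner,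
    because \<open>a + 2 * a\<close> vanishes modulo 3. This needs the partner \<open>d\<close> of
    \<open>b\<close> to have the parity of \<open>b\<close>.\<close>
  define c where "c = (if even b then (3 - a) mod 3 else a)"
  have "a < 3" using x ab by (simp add: twisted_def)
  then have c: "c < 3" "(c + (if even b then a else 2 * a)) mod 3 = 0"
    by (auto simp: c_def mod_simps)
  define d where "d = (2 ^ m - b) mod 2 ^ m"
  have "(d + b) mod 2 ^ m = 0"
    using x ab by (simp add: d_def twisted_def mod_simps)
  moreover have "even d \<longleftrightarrow> even b"
    using x ab m by (simp add: d_def twisted_def even_mod_power_two)
  ultimately show "\<exists>y\<in>carrier (twisted m). y \<otimes>\<^bsub>twisted m\<^esub> x = \<one>\<^bsub>twisted m\<^esub>"
    using c ab by (intro bexI[of _ "(c, d)"]) (auto simp: twisted_def d_def)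
qed (simp_all add: twisted_def split: prod.splits, auto)

text \<open>For odd \<open>b\<close> the square of \<open>(a, b)\<close> has first coordinate 0, so
  the first coordinate alternates between \<open>a\<close> and 0.\<close>

lemma nat_pow_twisted:
  assumes m: "1 \<le> m" and "a < 3"
  shows "(a, b) [^]\<^bsub>twisted m\<^esub> (k::nat) =
    ((if even b then k * a else if even k then 0 else a) mod 3, k * b mod 2 ^ m)"
proof (induction k)
  case (Suc k)
  have "(a, b) [^]\<^bsub>twisted m\<^esub> Suc k = (a, b) [^]\<^bsub>twisted m\<^esub> k \<otimes>\<^bsub>twisted m\<^esub> (a, b)"
    by (simp add: nat_pow_def)
  also have "\<dots> = ((if even b then Suc k * a else if even (Suc k) then 0 else a) mod 3, Suc k * b mod 2 ^ m)"
    unfolding Suc using m assms(2)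
    by (auto simp: twisted_def even_mod_power_two mod_simps add.commute)
  finally show ?case .
qed (simp add: nat_pow_def twisted_def)

text \<open>With \<open>k = m - 1\<close> this counts the cyclic subgroups inside the index-two
  subgroup of \<open>twisted m\<close>.\<close>

lemma card_divisors_three_times_power_two: "card {d::nat. d dvd 3 * 2 ^ k} = 2 * Suc k"
proof -
  have "{d::nat. d dvd 3 * 2 ^ k} = (\<lambda>i. 2 ^ i) ` {..k} \<union> (\<lambda>i. 3 * 2 ^ i) ` {..k}"
  proof (intro equalityI subsetI)
    fix d :: nat assume "d \<in> {d. d dvd 3 * 2 ^ k}"
    then have d: "d dvd 3 * 2 ^ k" by simp
    show "d \<in> (\<lambda>i. 2 ^ i) ` {..k} \<union> (\<lambda>i. 3 * 2 ^ i) ` {..k}"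
    proof (cases "3 dvd d")
      case True
      then obtain e where e: "d = 3 * e" by blast
      then have "e dvd 2 ^ k"
        using d by (simp only: nat_mult_dvd_cancel_disj) simp
      then obtain i where "i \<le> k" "e = 2 ^ i"
        using divides_primepow_nat[OF two_is_prime_nat] by blast
      then show ?thesis
        using e by blast
    next
      case False
      then have "coprime d 3"
        using prime_imp_coprime[of "3::nat" d] by (simp add: coprime_commute)
      then have "d dvd 2 ^ k"
        using d coprime_dvd_mult_right_iff by blast
      then obtain i where "i \<le> k" "d = 2 ^ i"
        using divides_primepow_nat[OF two_is_prime_nat] by blast
      then show ?thesis
        by blast
    qed
  next
    fix d :: nat assume "d \<in> (\<lambda>i. 2 ^ i) ` {..k} \<union> (\<lambda>i. 3 * 2 ^ i) ` {..k}"
    then obtain i where "i \<le> k" "d = 2 ^ i \<or> d = 3 * 2 ^ i" by auto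
    moreover have "(2::nat) ^ i dvd 2 ^ k" if "i \<le> k" using that by (rule le_imp_power_dvd)
    ultimately show "d \<in> {d. d dvd 3 * 2 ^ k}"
      by (metis dvd_mult dvd_refl mem_Collect_eq mult_dvd_mono)
  qed
  moreover have "(\<lambda>i. 2 ^ i) ` {..k} \<inter> (\<lambda>i. 3 * 2 ^ i) ` {..k} = ({} :: nat set)"
  proof -
    have "\<not> 3 dvd (2::nat) ^ i" for i
      using prime_dvd_power[of "3::nat" 2 i] by auto
    then have "2 ^ i \<noteq> 3 * (2::nat) ^ j" for i j
      by (metis dvd_triv_left)
    then show ?thesis
      by blast
  qed
  moreover have "card ((\<lambda>i. 2 ^ i :: nat) ` {..k}) = Suc k" "card ((\<lambda>i. 3 * 2 ^ i :: nat) ` {..k}) = Suc k"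
    by (subst card_image; simp add: inj_on_def)+
  ultimately show ?thesis
    by (simp add: card_Un_disjoint)
qed

text \<open>\<open>(1, 0)\<close> and \<open>(0, 1)\<close> do not commute.\<close>

lemma twisted_noncyclic:
  assumes m: "1 \<le> m"
  shows "\<not> cyclic_group (twisted m)"
proof
  assume cyc: "cyclic_group (twisted m)"
  interpret finite_group "twisted m" using m by (rule finite_group_twisted)
  interpret comm_group "twisted m" using cyc by (rule cyclic_imp_abelian_group)
  have "1 < (2::nat) ^ m" using m one_less_power[of "2::nat" m] by simp
  then have "(1, 0) \<otimes>\<^bsub>twisted m\<^esub> (0, 1) = (0, 1) \<otimes>\<^bsub>twisted m\<^esub> (1, 0)"
    by (intro m_comm) (auto simp: twisted_def)
  then show False
    using \<open>1 < 2 ^ m\<close> by (simp add: twisted_def)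
qed

text \<open>The elements with even second coordinate form a cyclic subgroup of order
  \<open>3 * 2 ^ (m - 1)\<close>, which contributes \<open>2 * m\<close>. Every other element
  generates one of the three subgroups generated by some \<open>(a, 1)\<close>.\<close>

lemma card_cyclic_subgroups_twisted:
  assumes m: "1 \<le> m"
  shows "card (cyclic_subgroups (twisted m)) = 2 * m + 3"
proof -
  interpret finite_group "twisted m" using m by (rule finite_group_twisted)
  define M :: nat where "M = 2 ^ (m - 1)"
  have M: "2 ^ m = 2 * M" "0 < M"
    using m by (cases m; simp add: M_def)+
  have carr: "carrier (twisted m) = {..<3} \<times> {..<2 * M}"
    by (simp add: twisted_def M)
  have one_eq: "\<one>\<^bsub>twisted m\<^esub> = (0, 0)"
    by (simp add: twisted_def)
  note pow = nat_pow_twisted[OF m, unfolded M(1)]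
  \<comment> \<open>For \<open>m = 1\<close> the second coordinate must be 0, hence the
    reduction.\<close>
  define z :: "nat \<times> nat" where "z = (1, 2 mod (2 * M))"
  have z: "z \<in> carrier (twisted m)"
    using M by (simp add: carr z_def)
  have zpow: "z [^]\<^bsub>twisted m\<^esub> (k::nat) = (k mod 3, 2 * (k mod M))" for k
  proof -
    have "even (2 mod (2 * M))"
      using M(1) m even_mod_power_two[of m 2] by simp
    then have "z [^]\<^bsub>twisted m\<^esub> k = (k mod 3, (k * 2) mod (2 * M))"
      by (simp add: z_def pow mod_mult_right_eq)
    then show ?thesis
      by (simp add: mult.commute[of k 2])
  qed
  have cop: "coprime 3 M"
    using prime_dvd_power[of "3::nat" 2 "m - 1"] prime_imp_coprime[of "3::nat" M] by (auto simp: M_def)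
  have "ord z = 3 * M"
  proof (subst ord_unique[OF z], intro allI)
    fix k :: nat
    have "z [^]\<^bsub>twisted m\<^esub> k = \<one>\<^bsub>twisted m\<^esub> \<longleftrightarrow> 3 dvd k \<and> M dvd k"
      by (auto simp: zpow one_eq)
    also have "\<dots> \<longleftrightarrow> 3 * M dvd k"
      using cop by (auto intro: divides_mult dest: dvd_mult_left dvd_mult_right)
    finally show "z [^]\<^bsub>twisted m\<^esub> k = \<one>\<^bsub>twisted m\<^esub> \<longleftrightarrow> 3 * M dvd k" .
  qed
  then have below: "card {C \<in> cyclic_subgroups (twisted m). C \<subseteq> generate (twisted m) {z}} = 2 * m"
    using card_cyclic_subgroups_below[OF z] card_divisors_three_times_power_two[of "m - 1"] m
    by (simp add: M_def)
  have genz: "(a, b) \<in> generate (twisted m) {z} \<longleftrightarrow> even b" if ab: "(a, b) \<in> carrier (twisted m)" for a b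
  proof
    assume "even b"
    then obtain e where e: "b = 2 * e" by blast
    obtain k where k: "[k = a] (mod 3)" "[k = e] (mod M)"
      using binary_chinese_remainder_nat[OF cop] by blast
    have "(a, b) = z [^]\<^bsub>twisted m\<^esub> k"
      using k ab by (simp add: zpow carr cong_def e)
    then show "(a, b) \<in> generate (twisted m) {z}"
      using z by (auto simp: generate_nat_pow)
  qed (auto simp: generate_nat_pow[OF z] zpow)
  define f where "f = (\<lambda>a::nat. generate (twisted m) {(a, 1)})"
  have one: "(a, 1) \<in> carrier (twisted m)" if "a < 3" for a
    using that M by (simp add: carr)
  have odd_gen: "generate (twisted m) {(a, b)} = f a" if ab: "(a, b) \<in> carrier (twisted m)" and "odd b" for a b
  proof -
    \<comment> \<open>An inverse \<open>k\<close> of \<open>b\<close> modulo \<open>2 ^ m\<close> is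
      odd, so raising to the power \<open>k\<close> keeps the first coordinate and turns
      \<open>b\<close> into 1.\<close>
    have "coprime b (2 ^ m)" using \<open>odd b\<close> by simp
    then obtain k where k: "[b * k = 1] (mod 2 ^ m)"
      by (metis cong_solve_coprime_nat One_nat_def)
    then have km: "k * b mod (2 * M) = 1"
      using M by (simp add: cong_def mult.commute)
    then have "odd k" using M(2) \<open>odd b\<close>
      by (metis dvd_mod_iff dvd_triv_left even_mult_iff odd_one)
    have "(a, b) [^]\<^bsub>twisted m\<^esub> k = (a, 1)"
      using ab \<open>odd b\<close> \<open>odd k\<close> km by (simp add: pow carr)
    then have "(a, 1) \<in> generate (twisted m) {(a, b)}"
      using nat_pow_in_generate[OF ab generate_singleton_self, of k] by simp
    moreover have "(a, 1) [^]\<^bsub>twisted m\<^esub> b = (a, b)"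
      using ab \<open>odd b\<close> by (simp add: pow carr)
    then have "(a, b) \<in> generate (twisted m) {(a, 1)}"
      using nat_pow_in_generate[OF one generate_singleton_self, of a b] ab by (simp add: carr)
    ultimately show ?thesis
      unfolding f_def using ab one[of a] by (intro equalityI generate_singleton_mono) (auto simp: carr)
  qed
  have "cyclic_subgroups (twisted m) =
    {C \<in> cyclic_subgroups (twisted m). C \<subseteq> generate (twisted m) {z}} \<union> f ` {..<3}"
  proof (intro equalityI subsetI)
    fix C assume C: "C \<in> cyclic_subgroups (twisted m)"
    then obtain a b where ab: "(a, b) \<in> carrier (twisted m)" "C = generate (twisted m) {(a, b)}"
      by (auto simp: cyclic_subgroups_eq)
    show "C \<in> {C \<in> cyclic_subgroups (twisted m). C \<subseteq> generate (twisted m) {z}} \<union> f ` {..<3}"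
    proof (cases "even b")
      case True
      then show ?thesis
        using C ab genz generate_singleton_mono[OF z] by auto
    next
      case False
      then show ?thesis
        using odd_gen[OF ab(1)] ab by (auto simp: carr)
    qed
  qed (use one in \<open>auto simp: f_def cyclic_subgroups_eq\<close>)
  moreover have "{C \<in> cyclic_subgroups (twisted m). C \<subseteq> generate (twisted m) {z}} \<inter> f ` {..<3} = {}"
    using genz[OF one] generate_singleton_self by (fastforce simp: f_def)
  moreover have "inj_on f {..<3}"
  proof (rule inj_onI)
    fix a c assume a: "a \<in> {..<3::nat}" and c: "c \<in> {..<3}" and "f a = f c"
    then have "(a, 1) \<in> generate (twisted m) {(c, 1)}"
      using generate_singleton_self by (metis f_def)
    then obtain k :: nat where "(a, 1) = (c, 1) [^]\<^bsub>twisted m\<^esub> k"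
      using one[of c] c by (auto simp: generate_nat_pow)
    \<comment> \<open>The second coordinate forces \<open>k\<close> to be odd, and then the first
      coordinate is \<open>c\<close>.\<close>
    then have "a = (if even k then 0 else c)" "k mod (2 * M) = 1"
      using c by (auto simp: pow split: if_splits)
    then show "a = c"
      by (metis dvd_mod_iff dvd_triv_left odd_one)
  qed
  then have "card (f ` {..<3}) = 3"
    by (simp add: card_image)
  ultimately show ?thesis
    using below finite_cyclic_subgroups by (metis (no_types, lifting) card_Un_disjoint finite_Un)
qed

text \<open>Every element squares to the identity, so the four elements generate four different
  subgroups, none of order 4.\<close>

lemma klein_four:
  defines "V \<equiv> integer_mod_group 2 \<times>\<times> integer_mod_group 2"
  shows "finite_group V" "card (cyclic_subgroups V) = 4" "\<not> cyclic_group V"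
proof -
  show V: "finite_group V"
    unfolding V_def by (intro finite_group_DirProd finite_group_integer_mod) auto
  interpret finite_group V by (fact V)
  have inv: "x \<otimes>\<^bsub>V\<^esub> x = \<one>\<^bsub>V\<^esub>" if "x \<in> carrier V" for x
    using that by (auto simp: V_def carrier_integer_mod_group)
  have card: "card (carrier V) = 4"
    by (simp add: V_def carrier_integer_mod_group)
  then show "card (cyclic_subgroups V) = 4"
    using card_cyclic_subgroups_exponent_two[OF inv] by simp
  show "\<not> cyclic_group V"
  proof
    assume "cyclic_group V"
    then obtain x where x: "x \<in> carrier V" "generate V {x} = carrier V"
      using cyclic_group_iff_generate by blast
    then have "carrier V = {\<one>\<^bsub>V\<^esub>, x}"
      using generate_involution[OF x(1) inv[OF x(1)]] by simp
    then have "card (carrier V) \<le> 2"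
      by (simp add: card_insert_if)
    then show False using card by simp
  qed
qed

section \<open>The classification\<close>

text \<open>The proper divisor is 4 if 4 divides \<open>n\<close>, the odd number
  \<open>n / 2\<close> if \<open>n\<close> is twice an odd number, and a factor of at least 5 if
  \<open>n\<close> is odd and composite. The excluded values are those where this fails.\<close>

lemma not_in_scrB_if_four_le_divisor:
  assumes "0 < n" and n: "n \<notin> {1, 4, 6, 9}" "\<not> prime n"
  shows "n \<notin> scrB"
proof -
  have four: "n \<notin> scrB" if "n = 4 * j" "2 \<le> j" for j
    using not_in_scrB_if_noncyclic_group[OF klein_four(1,3), of n j] that klein_four(2) by simp
  have odd: "n \<notin> scrB" if "n = k * j" "2 \<le> j" "odd k" "5 \<le> k" for k j
  proof -
    \<comment> \<open>Solves \<open>2 * m + 3 = k\<close>; \<open>k \<ge> 5\<close> is what makes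
      \<open>m \<ge> 1\<close>.\<close>
    have m: "1 \<le> (k - 3) div 2" "2 * ((k - 3) div 2) + 3 = k"
      using that(3,4) by presburger+
    then show ?thesis
      using not_in_scrB_if_noncyclic_group[OF finite_group_twisted twisted_noncyclic, of "(k - 3) div 2" n j]
        that card_cyclic_subgroups_twisted by simp
  qed
  have "(\<exists>j. n = 4 * j) \<or> (\<exists>q. n = 2 * q \<and> odd q) \<or> odd n"
    by presburger
  then consider j where "n = 4 * j" | q where "n = 2 * q" "odd q" | "odd n"
    by blast
  then show ?thesis
  proof cases
    case (1 j)
    then have "2 \<le> j" using assms by (cases "j = 0 \<or> j = 1") auto
    then show ?thesis using four 1 by blast
  next
    case (2 q)
    have "q \<noteq> 1" "q \<noteq> 3" using 2 n two_is_prime_nat by auto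
    then have "5 \<le> q" using \<open>odd q\<close> by presburger
    then show ?thesis using odd[of q 2] 2 by simp
  next
    case 3
    have "1 < n" using assms by (cases "n = 1") auto
    then obtain c d where cd: "n = c * d" "c \<noteq> 1" "d \<noteq> 1"
      using n(2) unfolding prime_nat_iff by (metis dvd_def mult.commute nat_mult_1_right)
    have "odd c" "odd d" using 3 cd by auto
    then have ge: "3 \<le> c" "3 \<le> d"
      using cd(2,3) by presburger+
    have "\<not> (c = 3 \<and> d = 3)" using cd n by auto
    then have "5 \<le> c \<or> 5 \<le> d"
      using ge \<open>odd c\<close> \<open>odd d\<close> by presburger
    then show ?thesis
      using odd[of c d] odd[of d c] cd ge \<open>odd c\<close> \<open>odd d\<close> by (auto simp: mult.commute)
  qed
qed

text \<open>The order is bounded in terms of \<open>n\<close>, which leaves finitely many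
  multiplication tables.\<close>

lemma in_scrB_if_divisors_less_four:
  assumes "0 < n" and divs: "\<And>k. k dvd n \<Longrightarrow> k < n \<Longrightarrow> k < 4"
  shows "n \<in> scrB"
proof -
  have "card (carrier G) \<le> n * fact n ^ n" if G: "G \<in> noncyclic_groups n" for G
    using G divs finite_group.card_carrier_le[OF noncyclic_group_imp_finite_group[OF G]]
    by (auto simp: noncyclic_groups_def)
  then show ?thesis
    using \<open>0 < n\<close> finite_quotient_if_bounded by (auto simp: scrB_def)
qed

theorem theorem1p5:
  shows "scrB = {1, 4, 6, 9} \<union> {p :: nat. prime p}"
proof (intro equalityI subsetI)
  fix n assume "n \<in> scrB"
  then show "n \<in> {1, 4, 6, 9} \<union> {p :: nat. prime p}"
    using not_in_scrB_if_four_le_divisor[of n] by (auto simp: scrB_def)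
next
  fix n assume n: "n \<in> {1, 4, 6, 9} \<union> {p :: nat. prime p}"
  show "n \<in> scrB"
  proof (rule in_scrB_if_divisors_less_four)
    show "0 < n" using n prime_gt_0_nat by auto
    fix k assume k: "k dvd n" "k < n"
    show "k < 4"
    proof (cases "prime n")
      case True
      then show ?thesis using k by (auto simp: prime_nat_iff)
    next
      case False
      then have "n = 1 \<or> n = 4 \<or> n = 6 \<or> n = 9" using n by auto
      then show ?thesis
      proof (elim disjE)
        assume "n = 9"
        with k have "k \<in> {0,1,2,3,4,5,6,7,8}" "k dvd 9" by auto
        then show ?thesis by auto
      next
        assume "n = 6"
        with k have "k \<in> {0,1,2,3,4,5}" "k dvd 6" by auto
        then show ?thesis by auto
      qed (use k in auto)
    qed
  qed
qed

end
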